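(* Let $f\in C(\mathbb{S}^1)$ be non-constant. Then there exists a homeomorphism $\underline\tau\in\mathrm{Homeo}(\mathbb{S}^1)$ such that \[ \overline{\dim}_{\mathrm{B}}\,\Gamma(f\circ\underline\tau)\;\geq\; 2-\frac{1}{\overline{\dim}_{\mathrm{MB}}\,\mathcal{T}(f)}. \]
   Context: $\mathbb{S}^1=[0,1]/_{0\sim 1}$ is the circle, $C(\mathbb{S}^1)$ is the set of continuous real-valued functions on $\mathbb{S}^1$, and $\mathrm{Homeo}(\mathbb{S}^1)$ is the set of homeomorphisms of $\mathbb{S}^1$ onto itself. A function on $\mathbb{S}^1$ is also regarded as a function $f$ on $[0,1]$ with $f(0)=f(1)$. Excursion functions and trees. An excursion function is a continuous $f:[0,1]\to[0,\infty)$ with $f(0)=f(1)=0$. For an excursion function $f$ and $0\le x\le y\le 1$ set $d_f(x,y)=d_f(y,x)=f(x)+f(y)-2\min_{z\in[x,y]}f(z)$. This is a pseudometric on $[0,1]$; identifying points at $d_f$-distance $0$ gives the metric space $\mathcal{T}(f)=([0,1]/_\sim,d_f)$, the real tree of $f$. For a general $f\in C(\mathbb{S}^1)$, let $a$ be a point where $f$ attains its minimum and let $\widetilde f(x)=f(x+a)-f(a)$, which is an excursion function; set $\mathcal{T}(f)=\mathcal{T}(\widetilde f)$. Graph: $\Gamma(f)=\{(x,f(x)) : x\in[0,1]\}\subset\mathbb{R}^2$ with the Euclidean metric. Upper box dimension: for a totally bounded metric space $X$, $\overline{\dim}_{\mathrm{B}} X=\limsup_{r\to0}\frac{\log N_r(X)}{-\log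 r}$, where $N_r(X)$ is the minimal number of sets of diameter at most $r$ needed to cover $X$. Modified upper box dimension: $\overline{\dim}_{\mathrm{MB}} X=\inf\{\sup_{i\in\mathbb{N}}\overline{\dim}_{\mathrm{B}} X_i : X=\bigcup_{i\in\mathbb{N}}X_i\}$, the infimum being over all countable covers of $X$. Convention: $1/\infty=0$. *)

theory Defs
  imports "HOL-Analysis.Analysis"
begin

section \<open>Box dimensions of metric spaces\<close>

text \<open>The diameter is always taken in the metric of the space. \<open>Least\<close> is only meaningful for totally
  bounded spaces, where a finite cover exists for every \<open>r > 0\<close>.\<close>

definition covering_number :: "'a metric \<Rightarrow> real \<Rightarrow> nat" where
  "covering_number m r =
     (LEAST n. \<exists>\<C>. finite \<C> \<and> card \<C> = n \<and> \<Union>\<C> = mspace m \<and>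
        (\<forall>U\<in>\<C>. \<forall>x\<in>U. \<forall>y\<in>U. mdist m x y \<le> r))"

text \<open>Values in the extended reals, since the dimension may be infinite. By \<open>ln 0 = 0\<close> the
  empty space gets dimension \<open>0\<close>.\<close>

definition upper_box_dim :: "'a metric \<Rightarrow> ereal" where
  "upper_box_dim m =
     Limsup (at_right 0) (\<lambda>r. ereal (ln (real (covering_number m r)) / - ln r))"

definition modified_upper_box_dim :: "'a metric \<Rightarrow> ereal" where
  "modified_upper_box_dim m =
     (INF X \<in> {X :: nat \<Rightarrow> 'a set. (\<Union>i. X i) = mspace m}.
        SUP i. upper_box_dim (submetric m (X i)))"


section \<open>The tree of an excursion function\<close>

definition excursion :: "(real \<Rightarrow> real) \<Rightarrow> bool" where
  "excursion g \<longleftrightarrow> continuous_on {0..1} g \<and> (\<forall>x\<in>{0..1}. 0 \<le> g x) \<and> g 0 = 0 \<and> g 1 = 0"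

definition exc_dist :: "(real \<Rightarrow> real) \<Rightarrow> real \<Rightarrow> real \<Rightarrow> real" where
  "exc_dist g x y = g x + g y - 2 * (INF z\<in>{min x y..max x y}. g z)"

definition exc_rel :: "(real \<Rightarrow> real) \<Rightarrow> (real \<times> real) set" where
  "exc_rel g = {(x, y). x \<in> {0..1} \<and> y \<in> {0..1} \<and> exc_dist g x y = 0}"

text \<open>The value \<open>0\<close> off the carrier is needed because \<^locale>\<open>Metric_space\<close> asks for nonnegativity
  and symmetry on the whole type. See \<open>mspace_exc_tree\<close> and \<open>mdist_exc_tree\<close> below.\<close>

definition exc_tree :: "(real \<Rightarrow> real) \<Rightarrow> real set metric" where
  "exc_tree g = metric ({0..1} // exc_rel g,
     \<lambda>A B. if A \<in> {0..1} // exc_rel g \<and> B \<in> {0..1} // exc_rel g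
            then exc_dist g (SOME x. x \<in> A) (SOME y. y \<in> B) else 0)"

lemma exc_inf_attained:
  assumes "excursion g" "x \<in> {0..1}" "y \<in> {0..1}"
  obtains z where "z \<in> {min x y..max x y}" "(INF z\<in>{min x y..max x y}. g z) = g z"
    "\<And>w. w \<in> {min x y..max x y} \<Longrightarrow> g z \<le> g w"
proof -
  have "continuous_on {min x y..max x y} g"
    using assms unfolding excursion_def by (elim conjE continuous_on_subset) auto
  then obtain z where z: "z \<in> {min x y..max x y}" "\<And>w. w \<in> {min x y..max x y} \<Longrightarrow> g z \<le> g w"
    using continuous_attains_inf[of "{min x y..max x y}" g]
    by (metis atLeastAtMost_iff compact_Icc empty_iff min.cobounded1 max.cobounded1)
  then have "(INF z\<in>{min x y..max x y}. g z) = g z"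
    by (intro cInf_eq_minimum) auto
  with z show ?thesis using that by blast
qed

lemma exc_dist_commute: "exc_dist g x y = exc_dist g y x"
  by (simp add: exc_dist_def min.commute max.commute)

lemma exc_dist_refl [simp]: "exc_dist g x x = 0"
  by (simp add: exc_dist_def)

lemma exc_dist_nonneg:
  assumes "excursion g" "x \<in> {0..1}" "y \<in> {0..1}"
  shows "0 \<le> exc_dist g x y"
proof -
  obtain z where z: "(INF z\<in>{min x y..max x y}. g z) = g z"
    "\<And>w. w \<in> {min x y..max x y} \<Longrightarrow> g z \<le> g w"
    using exc_inf_attained[OF assms] by blast
  have "g z \<le> g x" "g z \<le> g y" by (auto intro: z(2))
  then show ?thesis unfolding exc_dist_def z(1) by linarith
qed

lemma exc_dist_triangle:
  assumes "excursion g" "x \<in> {0..1}" "y \<in> {0..1}" "z \<in> {0..1}"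
  shows "exc_dist g x z \<le> exc_dist g x y + exc_dist g y z"
proof -
  obtain a where a: "(INF z\<in>{min x y..max x y}. g z) = g a"
    "\<And>w. w \<in> {min x y..max x y} \<Longrightarrow> g a \<le> g w"
    using exc_inf_attained[OF assms(1-3)] by blast
  obtain b where b: "(INF w\<in>{min y z..max y z}. g w) = g b"
    "\<And>w. w \<in> {min y z..max y z} \<Longrightarrow> g b \<le> g w"
    using exc_inf_attained[OF assms(1,3,4)] by blast
  obtain c where c: "c \<in> {min x z..max x z}" "(INF w\<in>{min x z..max x z}. g w) = g c"
    using exc_inf_attained[OF assms(1,2,4)] by blast
  have "g a \<le> g y" "g b \<le> g y" by (auto intro: a(2) b(2))
  moreover have "c \<in> {min x y..max x y} \<or> c \<in> {min y z..max y z}"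
    using c(1) by (auto simp: min_def max_def split: if_splits)
  then have "g a \<le> g c \<or> g b \<le> g c" using a(2) b(2) by blast
  ultimately show ?thesis unfolding exc_dist_def a(1) b(1) c(2) by linarith
qed

lemma equiv_exc_rel:
  assumes "excursion g"
  shows "equiv {0..1} (exc_rel g)"
proof (rule equivI)
  show "exc_rel g \<subseteq> {0..1} \<times> {0..1}" by (auto simp: exc_rel_def)
  show "refl_on {0..1} (exc_rel g)" by (auto simp: refl_on_def exc_rel_def)
  show "sym (exc_rel g)" by (auto simp: sym_def exc_rel_def exc_dist_commute)
  show "trans (exc_rel g)"
  proof (rule transI)
    fix x y z assume "(x, y) \<in> exc_rel g" "(y, z) \<in> exc_rel g"
    then show "(x, z) \<in> exc_rel g"
      using exc_dist_triangle[OF assms, of x y z] exc_dist_nonneg[OF assms, of x z]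
      by (auto simp: exc_rel_def)
  qed
qed

lemma exc_rel_some:
  assumes "excursion g" "A \<in> {0..1} // exc_rel g"
  shows "(SOME x. x \<in> A) \<in> A" "(SOME x. x \<in> A) \<in> {0..1}"
proof -
  have "A \<noteq> {}" using assms equiv_exc_rel in_quotient_imp_non_empty by metis
  then show "(SOME x. x \<in> A) \<in> A" by (simp add: some_in_eq)
  then show "(SOME x. x \<in> A) \<in> {0..1}"
    using in_quotient_imp_subset[OF equiv_exc_rel[OF assms(1)] assms(2)] by blast
qed

lemma Metric_space_exc_tree:
  assumes "excursion g"
  shows "Metric_space ({0..1} // exc_rel g)
    (\<lambda>A B. if A \<in> {0..1} // exc_rel g \<and> B \<in> {0..1} // exc_rel g
            then exc_dist g (SOME x. x \<in> A) (SOME y. y \<in> B) else 0)"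
proof
  fix A B
  assume AB: "A \<in> {0..1} // exc_rel g" "B \<in> {0..1} // exc_rel g"
  have "A = B" if "exc_dist g (SOME x. x \<in> A) (SOME y. y \<in> B) = 0"
  proof (rule quotient_eqI[OF equiv_exc_rel[OF assms] AB])
    show "(SOME x. x \<in> A) \<in> A" "(SOME x. x \<in> B) \<in> B"
      using exc_rel_some[OF assms] AB by auto
    show "(SOME x. x \<in> A, SOME x. x \<in> B) \<in> exc_rel g"
      using exc_rel_some[OF assms] AB that by (simp add: exc_rel_def)
  qed
  then show "(if A \<in> {0..1} // exc_rel g \<and> B \<in> {0..1} // exc_rel g
      then exc_dist g (SOME x. x \<in> A) (SOME y. y \<in> B) else 0) = 0 \<longleftrightarrow> A = B"
    using AB by auto
qed (auto simp: exc_dist_commute exc_rel_some[OF assms] simp del: atLeastAtMost_iff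
      intro!: exc_dist_nonneg[OF assms] exc_dist_triangle[OF assms])

lemma mspace_exc_tree:
  assumes "excursion g"
  shows "mspace (exc_tree g) = {0..1} // exc_rel g"
  unfolding exc_tree_def by (rule Metric_space.mspace_metric[OF Metric_space_exc_tree[OF assms]])

lemma mdist_exc_tree:
  assumes g: "excursion g" and x: "x \<in> {0..1}" and y: "y \<in> {0..1}"
  shows "mdist (exc_tree g) (exc_rel g `` {x}) (exc_rel g `` {y}) = exc_dist g x y"
proof -
  define u where "u = (SOME u. u \<in> exc_rel g `` {x})"
  define v where "v = (SOME v. v \<in> exc_rel g `` {y})"
  have q: "exc_rel g `` {x} \<in> {0..1} // exc_rel g" "exc_rel g `` {y} \<in> {0..1} // exc_rel g"
    using x y by (auto intro: quotientI)
  have "(x, u) \<in> exc_rel g" "(y, v) \<in> exc_rel g"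
    using exc_rel_some(1)[OF g q(1)] exc_rel_some(1)[OF g q(2)] by (auto simp: u_def v_def)
  then have uv: "u \<in> {0..1}" "v \<in> {0..1}" "exc_dist g x u = 0" "exc_dist g y v = 0"
    by (auto simp: exc_rel_def)
  have "exc_dist g u v = exc_dist g x y"
    using exc_dist_triangle[OF g x uv(1) y] exc_dist_triangle[OF g uv(1,2) y]
      exc_dist_triangle[OF g uv(1) x uv(2)] exc_dist_triangle[OF g x y uv(2)]
      uv(3,4) exc_dist_commute[of g u x] exc_dist_commute[of g v y] by linarith
  then show ?thesis
    using q unfolding exc_tree_def Metric_space.mdist_metric[OF Metric_space_exc_tree[OF g]]
    by (simp add: u_def v_def)
qed


section \<open>Functions on the circle\<close>

text \<open>The circle \<open>[0,1]/(0 \<sim> 1)\<close> is realised as the unit circle of the complex plane, with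
  quotient map \<open>x \<mapsto> exp (2 \<pi> i x)\<close>. The lemmas \<open>quotient_map_circle_point\<close> and
  \<open>circle_point_eq_iff\<close> show that this is the required quotient space.\<close>

abbreviation circle :: "complex set" where
  "circle \<equiv> sphere 0 1"

definition circle_point :: "real \<Rightarrow> complex" where
  "circle_point x = cis (2 * pi * x)"

lemma norm_circle_point [simp]: "norm (circle_point x) = 1"
  by (simp add: circle_point_def)

lemma continuous_on_circle_point [continuous_intros]:
  "continuous_on S h \<Longrightarrow> continuous_on S (\<lambda>x. circle_point (h x))"
  unfolding circle_point_def by (intro continuous_intros)

lemma circle_point_plus_1 [simp]: "circle_point (x + 1) = circle_point x"
  by (simp add: circle_point_def distrib_left flip: cis_mult)

lemma circle_point_eq_iff:
  assumes "x \<in> {0..1}" "y \<in> {0..1}"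
  shows "circle_point x = circle_point y \<longleftrightarrow> x = y \<or> {x, y} = {0, 1}"
proof
  assume "circle_point x = circle_point y"
  then have "exp (of_real (2 * pi * x) * \<i>) = exp (of_real (2 * pi * y) * \<i>)"
    by (simp add: circle_point_def cis_conv_exp mult.commute)
  then obtain n :: int
    where "of_real (2 * pi * x) * \<i> = of_real (2 * pi * y) * \<i> + (of_int (2 * n) * pi) * \<i>"
    using exp_eq by blast
  then have "Im (of_real (2 * pi * x) * \<i>)
      = Im (of_real (2 * pi * y) * \<i> + (of_int (2 * n) * pi) * \<i>)"
    by (rule arg_cong)
  then have "2 * pi * x = 2 * pi * (y + of_int n)" by (simp add: algebra_simps)
  then have n: "x = y + of_int n" by simp
  with assms have "- 1 \<le> real_of_int n" "real_of_int n \<le> 1" by auto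
  then have "n = -1 \<or> n = 0 \<or> n = 1" by linarith
  with n assms show "x = y \<or> {x, y} = {0, 1}" by auto
next
  assume "x = y \<or> {x, y} = {0, 1}"
  then show "circle_point x = circle_point y"
    by (auto simp: circle_point_def doubleton_eq_iff)
qed

lemma circle_point_image: "circle_point ` {0..1} = circle"
proof
  show "circle \<subseteq> circle_point ` {0..1}"
  proof
    fix z :: complex assume "z \<in> circle"
    then have z: "z = cis (Arg2pi z)"
      using Arg2pi_eq[of z] by (simp add: cis_conv_exp)
    have "z = circle_point (Arg2pi z / (2 * pi))"
      unfolding circle_point_def by (subst z) simp
    moreover have "Arg2pi z / (2 * pi) \<in> {0..1}"
      using Arg2pi_ge_0[of z] Arg2pi_lt_2pi[of z] by (simp add: field_simps)
    ultimately show "z \<in> circle_point ` {0..1}" by blast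
  qed
qed auto

lemma quotient_map_circle_point:
  "quotient_map (top_of_set {0..1}) (top_of_set circle) circle_point"
proof (rule T1_Spaces.continuous_imp_quotient_map)
  show "continuous_map (top_of_set {0..1}) (top_of_set circle) circle_point"
    by (auto intro!: continuous_intros)
  show "compact_space (top_of_set {0..1::real})"
    by (simp add: compact_space_subtopology)
  show "Hausdorff_space (top_of_set circle)"
    by (simp add: Hausdorff_space_subtopology)
  show "circle_point ` topspace (top_of_set {0..1}) = topspace (top_of_set circle)"
    by (simp add: circle_point_image)
qed

definition circle_graph :: "(complex \<Rightarrow> real) \<Rightarrow> (real \<times> real) set" where
  "circle_graph f = (\<lambda>x. (x, f (circle_point x))) ` {0..1}"

text \<open>Re-basing at a minimum point. Another choice of the minimum point gives an isometric tree.\<close>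

definition min_point :: "(complex \<Rightarrow> real) \<Rightarrow> real" where
  "min_point f = arg_min_on (\<lambda>x. f (circle_point x)) {0..1}"

definition rebase :: "(complex \<Rightarrow> real) \<Rightarrow> real \<Rightarrow> real" where
  "rebase f x = f (circle_point (x + min_point f)) - f (circle_point (min_point f))"

definition circle_tree :: "(complex \<Rightarrow> real) \<Rightarrow> real set metric" where
  "circle_tree f = exc_tree (rebase f)"

lemma excursion_rebase:
  assumes "continuous_on circle f"
  shows "excursion (rebase f)"
proof -
  have cont: "continuous_on S (\<lambda>x. f (circle_point (h x)))" if "continuous_on S h" 
    for S :: "real set" and h
    by (rule continuous_on_compose2[OF assms]) (auto intro!: continuous_intros that)
  obtain a where "a \<in> {0..1}" "\<And>x. x \<in> {0..1} \<Longrightarrow> f (circle_point a) \<le> f (circle_point x)"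
    using continuous_attains_inf[of "{0..1::real}" "\<lambda>x. f (circle_point x)"]
      cont[OF continuous_on_id] by auto
  then have "is_arg_min (\<lambda>x. f (circle_point x)) (\<lambda>x. x \<in> {0..1}) a"
    by (auto simp: is_arg_min_def not_less)
  then have "is_arg_min (\<lambda>x. f (circle_point x)) (\<lambda>x. x \<in> {0..1}) (min_point f)"
    unfolding min_point_def arg_min_on_def arg_min_def by (rule someI)
  then have "f (circle_point (min_point f)) \<le> f (circle_point x)" if "x \<in> {0..1}" for x
    using that by (force simp: is_arg_min_def not_less)
  then have "f (circle_point (min_point f)) \<le> f z" if "z \<in> circle" for z
    using that by (auto simp flip: circle_point_image)
  moreover have "circle_point (1 + min_point f) = circle_point (min_point f)"
    using circle_point_plus_1[of "min_point f"] by (simp only: add.commute)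
  ultimately show ?thesis
    unfolding excursion_def rebase_def by (auto intro!: continuous_intros cont)
qed

end

theory Submission
  imports Defs
begin

text \<open>
  The modified upper box dimension is at most the upper box dimension \<open>D\<close> of the tree, by the cover
  of the tree by itself, and \<open>2 - 1 / x\<close> increases in \<open>x > 0\<close>. So it suffices to reach the stronger
  bound \<open>2 - 1 / D\<close>.

  Write \<open>g\<close> for the excursion function. If the tree needs \<open>M\<close> sets of diameter \<open>s\<close>, there are \<open>M\<close>
  parameters in \<open>[0,1]\<close> whose tree distances exceed \<open>s / 2\<close>, so between any two of them \<open>g\<close>
  oscillates by more than \<open>s / 4\<close>. If a reparametrization puts neighbouring parameters at distance
  at least \<open>\<rho>\<close>, then over each of about \<open>M\<close> intervals the graph climbs by \<open>s / 4\<close>, which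
  takes about \<open>s / \<rho>\<close> sets of diameter below \<open>\<rho>\<close>, and a single set serves boundedly many
  intervals. Hence the graph needs about \<open>M s / \<rho>\<close> sets
  (\<open>covering_number_reparametrized_graph_ge\<close>). With \<open>\<rho>\<close> of order \<open>1 / M\<close> and \<open>M\<close> of order
  \<open>s\<close> to the power \<open>-D\<close>, this is \<open>\<rho>\<close> to the power \<open>-(2 - 1 / D)\<close>.

  One homeomorphism has to work at infinitely many scales \<open>s\<^sub>k\<close>. It spends a share proportional to
  \<open>1 / 2 ^ k\<close> of the parameter interval on the points of scale \<open>k\<close>
  (\<open>exists_spreading_function\<close>), so \<open>\<rho>\<^sub>k\<close> is of order \<open>1 / (2 ^ k M\<^sub>k)\<close>. Taking \<open>s\<^sub>k\<close> small in
  terms of \<open>k\<close> makes the factor \<open>2 ^ k\<close> invisible in the exponent (\<open>exponent_bound\<close>).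
\<close>

section \<open>Covering numbers and separated sets\<close>

lemma covering_number_le:
  assumes "finite \<C>" "\<Union>\<C> = mspace m" "\<And>U x y. U \<in> \<C> \<Longrightarrow> x \<in> U \<Longrightarrow> y \<in> U \<Longrightarrow> mdist m x y \<le> r"
  shows "covering_number m r \<le> card \<C>"
  unfolding covering_number_def by (rule Least_le) (intro exI[of _ \<C>] conjI ballI refl assms)

text \<open>A cover \<open>\<D>\<close> has to be supplied: without any finite cover the \<open>LEAST\<close> in the covering number is
  arbitrary and bounds nothing.\<close>

lemma separated_card_le_covering_number:
  assumes "finite \<D>" "\<Union>\<D> = mspace m" "\<And>U x y. U \<in> \<D> \<Longrightarrow> x \<in> U \<Longrightarrow> y \<in> U \<Longrightarrow> mdist m x y \<le> r"
    and p: "p ` I \<subseteq> mspace m" and sep: "\<And>i j. i \<in> I \<Longrightarrow> j \<in> I \<Longrightarrow> i \<noteq> j \<Longrightarrow> r < mdist m (p i) (p j)"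
  shows "card I \<le> covering_number m r"
proof -
  have "\<exists>n \<C>. finite \<C> \<and> card \<C> = n \<and> \<Union>\<C> = mspace m \<and>
      (\<forall>U\<in>\<C>. \<forall>x\<in>U. \<forall>y\<in>U. mdist m x y \<le> r)"
    by (intro exI[of _ "card \<D>"] exI[of _ \<D>] conjI ballI refl assms)
  from LeastI_ex[OF this] obtain \<C> where \<C>: "finite \<C>" "card \<C> = covering_number m r"
    "\<Union>\<C> = mspace m" "\<forall>U\<in>\<C>. \<forall>x\<in>U. \<forall>y\<in>U. mdist m x y \<le> r"
    unfolding covering_number_def by (elim exE conjE)
  have "\<forall>i\<in>I. \<exists>U\<in>\<C>. p i \<in> U" using p \<C>(3) by blast
  then obtain U where U: "\<And>i. i \<in> I \<Longrightarrow> U i \<in> \<C> \<and> p i \<in> U i" by metis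
  have "inj_on U I"
    by (rule inj_onI) (metis U \<C>(4) sep not_less)
  then have "card I \<le> card \<C>"
    by (rule card_inj_on_le) (use U \<C>(1) in auto)
  with \<C>(2) show ?thesis by simp
qed

text \<open>Greedy choice: as long as fewer points than the covering number are chosen, the balls of radius
  \<open>r / 2\<close> about them have diameter at most \<open>r\<close> and cannot cover the space, by minimality. This
  argument works in every metric space, also where no finite cover exists.\<close>

lemma exists_separated_set:
  assumes "n \<le> covering_number m r" and "0 \<le> r"
  shows "\<exists>S. finite S \<and> card S = n \<and> S \<subseteq> mspace m \<and>
    (\<forall>x\<in>S. \<forall>y\<in>S. x \<noteq> y \<longrightarrow> r / 2 < mdist m x y)"
  using assms(1)
proof (induction n)
  case 0
  show ?case by (intro exI[of _ "{}"]) auto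
next
  case (Suc n)
  then obtain S where S: "finite S" "card S = n" "S \<subseteq> mspace m"
    "\<And>x y. x \<in> S \<Longrightarrow> y \<in> S \<Longrightarrow> x \<noteq> y \<Longrightarrow> r / 2 < mdist m x y" by force
  have "\<exists>z\<in>mspace m. \<forall>x\<in>S. r / 2 < mdist m x z"
  proof (rule ccontr)
    assume "\<not> ?thesis"
    then have near: "\<exists>x\<in>S. mdist m x z \<le> r / 2" if "z \<in> mspace m" for z
      using that by (meson not_less)
    let ?B = "\<lambda>x. {z \<in> mspace m. mdist m x z \<le> r / 2}"
    have "covering_number m r \<le> card (?B ` S)"
    proof (rule covering_number_le)
      show "\<Union> (?B ` S) = mspace m" using near by blast
      show "mdist m y z \<le> r" if "U \<in> ?B ` S" "y \<in> U" "z \<in> U" for U y z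
      proof -
        from that(1) obtain x where x: "x \<in> S" "U = ?B x" by blast
        have "mdist m y z \<le> mdist m y x + mdist m x z"
          using x S(3) that by (intro mdist_triangle) auto
        moreover have "mdist m y x \<le> r / 2" "mdist m x z \<le> r / 2"
          using x that by (auto simp: mdist_commute)
        ultimately show ?thesis by linarith
      qed
    qed (use S in auto)
    also have "\<dots> \<le> n" using card_image_le[OF S(1)] S(2) by blast
    finally show False using Suc.prems by simp
  qed
  then obtain z where z: "z \<in> mspace m" "\<And>x. x \<in> S \<Longrightarrow> r / 2 < mdist m x z" by blast
  have "mdist m z z = 0" using z(1) by simp
  then have "z \<notin> S" using z(2)[of z] assms(2) by auto
  then show ?case
    using S z by (intro exI[of _ "insert z S"]) (auto simp: mdist_commute)
qed

section \<open>Upper box dimension\<close>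

lemma upper_box_dim_nonneg: "0 \<le> upper_box_dim m"
proof -
  have "eventually (\<lambda>r::real. r < 1) (at_right 0)"
    by (rule eventually_at_rightI[of 0 1]) auto
  moreover have "eventually (\<lambda>r::real. 0 < r) (at_right 0)"
    by (rule eventually_at_rightI[of 0 1]) auto
  ultimately have "eventually (\<lambda>r. 0 \<le> ereal (ln (real (covering_number m r)) / - ln r)) (at_right 0)"
  proof eventually_elim
    case (elim r)
    then have "0 \<le> - ln r" "0 \<le> ln (real (covering_number m r))"
      by (auto simp: ln_ge_zero_iff) (cases "covering_number m r = 0"; simp)
    then show ?case by (simp add: divide_nonneg_nonpos)
  qed
  then show ?thesis unfolding upper_box_dim_def by (intro le_Limsup) simp_all
qed

lemma modified_upper_box_dim_nonneg: "0 \<le> modified_upper_box_dim m"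
  unfolding modified_upper_box_dim_def
  by (intro INF_greatest SUP_upper2[of 0] upper_box_dim_nonneg) auto

lemma modified_upper_box_dim_le: "modified_upper_box_dim m \<le> upper_box_dim m"
proof -
  have "modified_upper_box_dim m \<le> (SUP i::nat. upper_box_dim (submetric m (mspace m)))"
    unfolding modified_upper_box_dim_def by (rule INF_lower) auto
  then show ?thesis by (simp add: submetric_mspace)
qed

lemma exists_scale_above_exponent:
  assumes "ereal c < upper_box_dim m" "0 < \<delta>"
  shows "\<exists>s>0. s < \<delta> \<and> c < ln (real (covering_number m s)) / - ln s"
proof (rule ccontr)
  assume "\<not> ?thesis"
  then have "ln (real (covering_number m s)) / - ln s \<le> c" if "0 < s" "s < \<delta>" for s
    using that by (meson not_le)
  then have "eventually (\<lambda>s. ereal (ln (real (covering_number m s)) / - ln s) \<le> ereal c) (at_right 0)"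
    using assms(2) by (intro eventually_at_rightI[of 0 \<delta>]) auto
  then have "upper_box_dim m \<le> ereal c" unfolding upper_box_dim_def by (rule Limsup_bounded)
  with assms(1) show False by simp
qed

lemma le_Limsup_along:
  fixes \<Phi> :: "'a \<Rightarrow> ereal"
  assumes "filterlim r F sequentially" "b \<longlonglongrightarrow> l" "\<And>k. b k \<le> \<Phi> (r k)"
  shows "l \<le> Limsup F \<Phi>"
proof (rule ccontr)
  assume "\<not> ?thesis"
  then have "Limsup F \<Phi> < l" by simp
  from dense[OF this] obtain y where y: "Limsup F \<Phi> < y" "y < l" by blast
  have "eventually (\<lambda>k. \<Phi> (r k) < y) sequentially"
    by (rule eventually_compose_filterlim[OF Limsup_lessD[OF y(1)] assms(1)])
  then have "eventually (\<lambda>k. b k \<le> y) sequentially"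
    by (rule eventually_mono) (rule order_trans[OF assms(3) less_imp_le])
  then have "l \<le> y" using tendsto_upperbound[OF assms(2)] by simp
  with y show False by simp
qed

section \<open>Homeomorphisms of the interval and the circle\<close>

text \<open>The distribution function of the measure that adds to Lebesgue measure, for every \<open>k\<close>, the
  mass \<open>1 / 2 ^ k\<close> shared equally by the points of \<open>P k\<close>. Each atom \<open>p\<close> is smeared out
  uniformly to its right, over a length \<open>d\<close> that is at most the distance to any other point of \<open>P k\<close>; so it
  is fully counted at the next point, and the distribution function stays continuous. Rescaling to
  \<open>h 1 = 1\<close> divides by the total mass, which is at most \<open>1 + 2 = 3\<close>; hence the factor \<open>3\<close> in the
  conclusion.\<close>

lemma exists_spreading_function:
  fixes P :: "nat \<Rightarrow> real set"
  assumes fin: "\<And>k. finite (P k)"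
  obtains h :: "real \<Rightarrow> real" where "continuous_on {0..1} h" "strict_mono_on {0..1} h" "h 0 = 0" "h 1 = 1"
    "\<And>k x y. x \<in> P k \<Longrightarrow> y \<in> P k \<Longrightarrow> 0 \<le> x \<Longrightarrow> x < y \<Longrightarrow> y \<le> 1 \<Longrightarrow>
       1 / (3 * 2 ^ k * real (card (P k))) \<le> h y - h x"
proof -
  have "\<exists>d>0. \<forall>y\<in>P k. y \<noteq> x \<longrightarrow> d \<le> dist x y" for k x
    using finite_set_avoid[OF fin, of k x] by blast
  then obtain d where d: "\<And>k x. 0 < d k x" "\<And>k x y. y \<in> P k \<Longrightarrow> y \<noteq> x \<Longrightarrow> d k x \<le> dist x y"
    by metis
  define c where "c = (\<lambda>k p x. min 1 (max 0 ((x - p) / d k p)))"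
  define G where "G = (\<lambda>k x. (\<Sum>p\<in>P k. c k p x) / card (P k))"
  have c: "0 \<le> c k p x" "c k p x \<le> 1" for k p x by (auto simp: c_def)
  have c_mono: "c k p x \<le> c k p y" if "x \<le> y" for k p x y
    unfolding c_def using that d(1)[of k p]
    by (intro min.mono max.mono order_refl divide_right_mono) auto
  have G: "0 \<le> G k x" "G k x \<le> 1" for k x
  proof -
    show "0 \<le> G k x" unfolding G_def by (intro divide_nonneg_nonneg sum_nonneg c) auto
    have "(\<Sum>p\<in>P k. c k p x) \<le> (\<Sum>p\<in>P k. 1)" by (intro sum_mono c)
    then show "G k x \<le> 1" unfolding G_def by (cases "card (P k) = 0") (simp_all add: divide_le_eq_1)
  qed
  have G_mono: "G k x \<le> G k y" if "x \<le> y" for k x y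
    unfolding G_def by (intro divide_right_mono sum_mono c_mono that) auto
  have G_jump: "1 / card (P k) \<le> G k y - G k x" if "x \<in> P k" "y \<in> P k" "x < y" for k x y
  proof -
    have "c k x x = 0" by (simp add: c_def)
    moreover have "c k x y = 1"
      using d(1)[of k x] d(2)[OF that(2), of x] that(3) by (simp add: c_def dist_real_def)
    ultimately have "1 = c k x y - c k x x" by simp
    also have "\<dots> \<le> (\<Sum>p\<in>P k. c k p y - c k p x)"
      using that c_mono[of x y] by (intro member_le_sum fin) auto
    finally show ?thesis
      unfolding G_def by (simp add: sum_subtractf divide_right_mono flip: diff_divide_distrib)
  qed
  have G_cont: "continuous_on {0..1} (G k)" for k
  proof -
    have "d k p \<noteq> 0" for p using d(1)[of k p] by simp
    then show ?thesis
      unfolding G_def c_def by (cases "card (P k) = 0") (auto intro!: continuous_intros)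
  qed
  define F where "F = (\<lambda>x. x + (\<Sum>k. (1/2)^k * G k x))"
  have geo: "summable (\<lambda>k. (1/2::real)^k)" "(\<Sum>k. (1/2::real)^k) = 2"
    by (auto simp: suminf_geometric)
  have bound: "norm ((1/2)^k * G k x) \<le> (1/2)^k" for k x
    using G[of k x] by (simp add: abs_mult)
  have summ: "summable (\<lambda>k. (1/2)^k * G k x)" for x
    by (rule summable_comparison_test'[OF geo(1)]) (rule bound)
  have F_diff: "F y - F x = (y - x) + (\<Sum>k. (1/2)^k * (G k y - G k x))" for x y
    unfolding F_def by (simp add: suminf_diff[OF summ summ] right_diff_distrib)
  have summ_diff: "summable (\<lambda>k. (1/2)^k * (G k y - G k x))" for x y
    using summable_diff[OF summ summ] by (simp add: right_diff_distrib)
  have F_jump: "(y - x) + (1/2)^k * (G k y - G k x) \<le> F y - F x" if "x \<le> y" for k x y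
  proof -
    have "(\<Sum>i\<in>{k}. (1/2)^i * (G i y - G i x)) \<le> (\<Sum>k. (1/2)^k * (G k y - G k x))"
      using G_mono[OF that] by (intro sum_le_suminf summ_diff) auto
    then show ?thesis unfolding F_diff by simp
  qed
  have F_strict: "F x < F y" if "x < y" for x y
    using F_jump[of x y 0] G_mono[of x y 0] that by auto
  have F_cont: "continuous_on {0..1} F"
  proof -
    have "uniform_limit {0..1} (\<lambda>n x. \<Sum>k<n. (1/2)^k * G k x) (\<lambda>x. \<Sum>k. (1/2)^k * G k x) sequentially"
      by (rule Weierstrass_m_test[OF _ geo(1)]) (rule bound)
    then have "continuous_on {0..1} (\<lambda>x. \<Sum>k. (1/2)^k * G k x)"
      by (rule uniform_limit_theorem[rotated]) (auto intro!: continuous_intros G_cont always_eventually)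
    then show ?thesis unfolding F_def by (intro continuous_intros)
  qed
  define L where "L = F 1 - F 0"
  have "0 < L" using F_strict[of 0 1] by (simp add: L_def)
  have "(\<Sum>k. (1/2)^k * (G k 1 - G k 0)) \<le> (\<Sum>k. (1/2)^k)"
  proof (rule suminf_le[OF _ summ_diff geo(1)])
    show "(1/2)^k * (G k 1 - G k 0) \<le> (1/2)^k" for k
      using G[of k 1] G[of k 0] by (intro mult_left_le) auto
  qed
  then have "L \<le> 3" unfolding L_def F_diff geo(2) by simp
  show ?thesis
  proof (rule that[of "\<lambda>x. (F x - F 0) / L"])
    show "strict_mono_on {0..1} (\<lambda>x. (F x - F 0) / L)"
      using F_strict \<open>0 < L\<close> by (auto simp: strict_mono_on_def divide_strict_right_mono)
    show "1 / (3 * 2 ^ k * real (card (P k))) \<le> (F y - F 0) / L - (F x - F 0) / L"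
      if "x \<in> P k" "y \<in> P k" "x < y" for k x y
    proof -
      have "1 / (3 * 2 ^ k * real (card (P k))) = (1/2)^k * (1 / card (P k)) / 3"
        by (simp add: power_one_over)
      also have "\<dots> \<le> (1/2)^k * (G k y - G k x) / 3"
        using G_jump[OF that] by (intro divide_right_mono mult_left_mono) auto
      also have "\<dots> \<le> (F y - F x) / 3"
        using F_jump[of x y k] that(3) by (intro divide_right_mono) auto
      also have "\<dots> \<le> (F y - F x) / L"
        using \<open>0 < L\<close> \<open>L \<le> 3\<close> F_strict[OF that(3)] by (intro divide_left_mono) auto
      finally show ?thesis by (simp add: diff_divide_distrib)
    qed
  qed (use \<open>0 < L\<close> in \<open>auto simp: L_def intro!: continuous_intros F_cont\<close>)
qed

text \<open>The map is defined by choosing parameters; as \<open>\<kappa>\<close> fixes both endpoints, the ambiguity between the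
  parameters \<open>0\<close> and \<open>1\<close> is harmless, and continuity descends along the quotient map
  \<open>circle_point\<close>. The shift \<open>a\<close> is there because the excursion function starts at a minimum point.\<close>

lemma circle_reparametrization:
  fixes \<kappa> :: "real \<Rightarrow> real"
  assumes cont: "continuous_on {0..1} \<kappa>" and bij: "bij_betw \<kappa> {0..1} {0..1}"
    and ends: "\<kappa> 0 = 0" "\<kappa> 1 = 1"
  obtains \<tau> \<sigma> where "homeomorphism circle circle \<tau> \<sigma>"
    "\<And>t. t \<in> {0..1} \<Longrightarrow> \<tau> (circle_point t) = circle_point (\<kappa> t + a)"
proof -
  have add: "circle_point (x + y) = circle_point x * circle_point y" for x y
    by (simp add: circle_point_def distrib_left flip: cis_mult)
  have \<kappa>01: "\<kappa> t \<in> {0..1}" if "t \<in> {0..1}" for t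
    using bij that by (auto simp: bij_betw_def)
  have \<kappa>_eq: "\<kappa> t = \<kappa> u \<longleftrightarrow> t = u" if "t \<in> {0..1}" "u \<in> {0..1}" for t u
    using bij that by (auto simp: bij_betw_def inj_on_def)
  have \<kappa>_circle_eq: "circle_point (\<kappa> t) = circle_point (\<kappa> u) \<longleftrightarrow> circle_point t = circle_point u"
    if tu: "t \<in> {0..1}" "u \<in> {0..1}" for t u
  proof -
    have \<kappa>0: "\<kappa> t = 0 \<longleftrightarrow> t = 0" "\<kappa> u = 0 \<longleftrightarrow> u = 0" "\<kappa> t = 1 \<longleftrightarrow> t = 1" "\<kappa> u = 1 \<longleftrightarrow> u = 1"
      using \<kappa>_eq[of t 0] \<kappa>_eq[of u 0] \<kappa>_eq[of t 1] \<kappa>_eq[of u 1] tu ends by auto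
    show ?thesis
      unfolding circle_point_eq_iff[OF tu] circle_point_eq_iff[OF \<kappa>01[OF tu(1)] \<kappa>01[OF tu(2)]]
        doubleton_eq_iff \<kappa>0 \<kappa>_eq[OF tu] ..
  qed
  define \<tau> where "\<tau> = (\<lambda>z. circle_point (\<kappa> (SOME t. t \<in> {0..1} \<and> circle_point t = z) + a))"
  have \<tau>: "\<tau> (circle_point t) = circle_point (\<kappa> t + a)" if t: "t \<in> {0..1}" for t
  proof -
    define u where "u = (SOME u. u \<in> {0..1} \<and> circle_point u = circle_point t)"
    have "u \<in> {0..1} \<and> circle_point u = circle_point t"
      unfolding u_def by (rule someI[of _ t]) (use t in auto)
    then have "circle_point (\<kappa> u) = circle_point (\<kappa> t)" using \<kappa>_circle_eq t by blast
    then show ?thesis unfolding \<tau>_def u_def[symmetric] add by simp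
  qed
  have "continuous_map (top_of_set {0..1}) (top_of_set circle) (\<tau> \<circ> circle_point)"
  proof -
    have "continuous_on {0..1} (\<lambda>t. circle_point (\<kappa> t + a))" by (intro continuous_intros cont)
    then have "continuous_on {0..1} (\<tau> \<circ> circle_point)"
      by (rule continuous_on_eq) (simp add: \<tau>)
    then show ?thesis by (auto simp: \<tau>)
  qed
  then have "continuous_map (top_of_set circle) (top_of_set circle) \<tau>"
    by (rule continuous_compose_quotient_map[OF quotient_map_circle_point])
  then have \<tau>_cont: "continuous_on circle \<tau>" by simp
  have "inj_on \<tau> circle"
    by (auto simp: inj_on_def \<tau> add \<kappa>_circle_eq circle_point_def[of a] simp flip: circle_point_image)
  moreover have "\<tau> ` circle = circle"
  proof
    show "\<tau> ` circle \<subseteq> circle" by (auto simp: \<tau>_def)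
    show "circle \<subseteq> \<tau> ` circle"
    proof
      fix z :: complex assume "z \<in> circle"
      then have "z * circle_point (- a) \<in> circle" by (simp add: norm_mult)
      then obtain x where x: "x \<in> {0..1}" "circle_point x = z * circle_point (- a)"
        unfolding circle_point_image[symmetric] by auto
      then obtain t where t: "t \<in> {0..1}" "\<kappa> t = x" using bij_betw_imp_surj_on[OF bij] by (metis imageE)
      have "circle_point (- a) * circle_point a = 1"
        using add[of "- a" a] by (simp add: circle_point_def)
      then have "z = \<tau> (circle_point t)" using x t by (simp add: \<tau> add mult.assoc)
      then show "z \<in> \<tau> ` circle" by simp
    qed
  qed
  ultimately obtain \<sigma> where "homeomorphism circle circle \<tau> \<sigma>"
    using homeomorphism_compact[OF compact_sphere \<tau>_cont] by blast
  with \<tau> show ?thesis using that by blast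
qed

section \<open>Graphs that oscillate on many intervals\<close>

text \<open>The graph contains a \<open>\<rho>\<close>-separated set of the required size: over each interval take the points
  where \<open>\<phi>\<close> assumes the values \<open>\<phi> a + j \<rho>\<close> between \<open>\<phi> a\<close> and \<open>\<phi> b\<close>. Points over the
  same interval differ by \<open>\<rho>\<close> in the second coordinate, points over different intervals in
  the first.\<close>

lemma covering_number_graph_ge:
  fixes \<phi> :: "real \<Rightarrow> real" and u v :: "nat \<Rightarrow> real" and m :: nat
  assumes cont: "continuous_on {0..1} \<phi>"
    and uv: "\<And>i. i < m \<Longrightarrow> 0 \<le> u i \<and> v i \<le> 1"
    and apart: "\<And>i j. i < j \<Longrightarrow> j < m \<Longrightarrow> v i + \<rho> \<le> u j"
    and osc: "\<And>i. i < m \<Longrightarrow> \<exists>a\<in>{u i..v i}. \<exists>b\<in>{u i..v i}. \<phi> a + L \<le> \<phi> b"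
    and r: "0 < r" "r < \<rho>" and L: "0 \<le> L"
  shows "m * (L / \<rho>) \<le> covering_number (submetric euclidean_metric ((\<lambda>t. (t, \<phi> t)) ` {0..1})) r"
proof -
  let ?G = "(\<lambda>t. (t, \<phi> t)) ` {0..1}"
  obtain a b where ab: "\<And>i. i < m \<Longrightarrow> a i \<in> {u i..v i}" "\<And>i. i < m \<Longrightarrow> b i \<in> {u i..v i}"
    "\<And>i. i < m \<Longrightarrow> \<phi> (a i) + L \<le> \<phi> (b i)"
    using osc by metis
  define n where "n = nat \<lfloor>L / \<rho>\<rfloor>"
  have n: "real n \<le> L / \<rho>" "L / \<rho> \<le> n + 1"
    using r L by (auto simp: n_def) linarith
  have "\<exists>t\<in>{u i..v i}. \<phi> t = \<phi> (a i) + j * \<rho>" if "i < m" "j \<le> n" for i j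
  proof -
    have seg: "closed_segment (a i) (b i) \<subseteq> {u i..v i}"
      using ab(1,2)[OF that(1)] by (auto simp: closed_segment_eq_real_ivl split: if_splits)
    have "j * \<rho> \<le> n * \<rho>" using that r by (intro mult_right_mono) auto
    also have "\<dots> \<le> L" using n(1) r by (simp add: pos_le_divide_eq)
    finally have "j * \<rho> \<le> L" .
    moreover have "0 \<le> j * \<rho>" using r by simp
    ultimately have "\<phi> (a i) + j * \<rho> \<in> closed_segment (\<phi> (a i)) (\<phi> (b i))"
      using ab(3)[OF that(1)] by (simp add: closed_segment_eq_real_ivl1)
    moreover have "continuous_on (closed_segment (a i) (b i)) \<phi>"
      using uv[OF that(1)] seg by (intro continuous_on_subset[OF cont]) auto
    ultimately show ?thesis using IVT'_closed_segment_real seg by blast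
  qed
  then obtain t where t: "\<And>i j. i < m \<Longrightarrow> j \<le> n \<Longrightarrow> t i j \<in> {u i..v i}"
    "\<And>i j. i < m \<Longrightarrow> j \<le> n \<Longrightarrow> \<phi> (t i j) = \<phi> (a i) + real j * \<rho>"
    by metis
  define p where "p = (\<lambda>(i, j). (t i j, \<phi> (t i j)))"
  let ?I = "{..<m} \<times> {..n}"
  have "compact ?G"
    by (intro compact_continuous_image continuous_intros cont) simp
  then obtain K where K: "finite K" "?G \<subseteq> (\<Union>x\<in>K. ball x (r / 2))"
    using r(1) compact_eq_totally_bounded[of ?G] by (meson half_gt_zero)
  have "card ?I \<le> covering_number (submetric euclidean_metric ?G) r"
  proof (rule separated_card_le_covering_number)
    show "finite ((\<lambda>x. ball x (r / 2) \<inter> ?G) ` K)" using K by simp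
    show "\<Union> ((\<lambda>x. ball x (r / 2) \<inter> ?G) ` K) = mspace (submetric euclidean_metric ?G)"
      using K by auto
    show "mdist (submetric euclidean_metric ?G) x y \<le> r"
      if "U \<in> (\<lambda>x. ball x (r / 2) \<inter> ?G) ` K" "x \<in> U" "y \<in> U" for U x y
    proof -
      from that obtain z where "dist z x < r / 2" "dist z y < r / 2" by auto
      then show ?thesis using dist_triangle3[of x y z] by simp
    qed
    show "p ` ?I \<subseteq> mspace (submetric euclidean_metric ?G)"
    proof
      fix y assume "y \<in> p ` ?I"
      then obtain i j where ij: "i < m" "j \<le> n" "y = (t i j, \<phi> (t i j))" by (auto simp: p_def)
      have "t i j \<in> {0..1}" using t(1)[OF ij(1,2)] uv[OF ij(1)] by auto
      then show "y \<in> mspace (submetric euclidean_metric ?G)" using ij(3) by auto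
    qed
    show "r < mdist (submetric euclidean_metric ?G) (p x) (p y)"
      if xy: "x \<in> ?I" "y \<in> ?I" "x \<noteq> y" for x y
    proof -
      obtain i j i' j' where ij: "x = (i, j)" "y = (i', j')" by fastforce
      have "\<rho> \<le> dist (p x) (p y)"
      proof (cases "i = i'")
        case True
        then have "j \<noteq> j'" using ij xy by auto
        then have "1 \<le> \<bar>real j - real j'\<bar>" by linarith
        then have "\<rho> \<le> \<bar>real j - real j'\<bar> * \<rho>" using r by simp
        also have "\<dots> = \<bar>(real j - real j') * \<rho>\<bar>" using r by (simp add: abs_mult)
        also have "\<dots> = dist (snd (p x)) (snd (p y))"
          using xy t(2) by (simp add: ij p_def True dist_real_def left_diff_distrib)
        also have "\<dots> \<le> dist (p x) (p y)" by (rule dist_snd_le)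
        finally show ?thesis .
      next
        case False
        have "\<rho> \<le> dist (fst (p x)) (fst (p y))"
          using xy False t(1)[of i j] t(1)[of i' j'] apart[of i i'] apart[of i' i]
          by (cases i i' rule: linorder_cases) (auto simp: ij p_def dist_real_def)
        also have "\<dots> \<le> dist (p x) (p y)" by (rule dist_fst_le)
        finally show ?thesis .
      qed
      then show ?thesis using r by simp
    qed
  qed
  then have "real m * (real n + 1) \<le> covering_number (submetric euclidean_metric ?G) r"
    by (simp add: card_cartesian_product algebra_simps flip: of_nat_le_iff[where ?'a = real])
  moreover have "m * (L / \<rho>) \<le> real m * (real n + 1)"
    using n by (intro mult_left_mono) auto
  ultimately show ?thesis by linarith
qed

section \<open>From the tree to the graph\<close>

lemma exc_tree_separated_points:
  assumes g: "excursion g" and s: "0 \<le> s"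
  obtains P where "finite P" "P \<subseteq> {0..1}" "card P = covering_number (exc_tree g) s"
    "\<And>x y. x \<in> P \<Longrightarrow> y \<in> P \<Longrightarrow> x \<noteq> y \<Longrightarrow> s / 2 < exc_dist g x y"
proof -
  obtain S where S: "finite S" "card S = covering_number (exc_tree g) s" "S \<subseteq> {0..1} // exc_rel g"
    "\<And>A B. A \<in> S \<Longrightarrow> B \<in> S \<Longrightarrow> A \<noteq> B \<Longrightarrow> s / 2 < mdist (exc_tree g) A B"
    using exists_separated_set[OF order_refl s, of "exc_tree g"] mspace_exc_tree[OF g] by auto
  have "\<exists>x\<in>{0..1}. exc_rel g `` {x} = A" if "A \<in> S" for A
    using S(3) that by (auto simp: quotient_def)
  then obtain x where x: "\<And>A. A \<in> S \<Longrightarrow> x A \<in> {0..1}" "\<And>A. A \<in> S \<Longrightarrow> exc_rel g `` {x A} = A"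
    by metis
  have dist: "s / 2 < exc_dist g (x A) (x B)" if "A \<in> S" "B \<in> S" "x A \<noteq> x B" for A B
    using that S(4)[OF that(1,2)] mdist_exc_tree[OF g x(1) x(1), OF that(1,2)] x(2) by auto
  have "inj_on x S" by (metis x(2) inj_onI)
  then show ?thesis
    by (intro that[of "x ` S"]) (use S x(1) dist in \<open>auto simp: card_image\<close>)
qed

text \<open>The tree distance is the sum of the two climbs from the minimum on \<open>[x, y]\<close> to the endpoints, so
  one of them is at least half of it.\<close>

lemma exc_dist_imp_oscillation:
  assumes "excursion g" "0 \<le> x" "x \<le> y" "y \<le> 1" "2 * L \<le> exc_dist g x y"
  shows "\<exists>a\<in>{x..y}. \<exists>b\<in>{x..y}. g a + L \<le> g b"
proof -
  obtain z where z: "z \<in> {min x y..max x y}" "(INF z\<in>{min x y..max x y}. g z) = g z"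
    using exc_inf_attained[of g x y] assms by auto
  have "g z + L \<le> g x \<or> g z + L \<le> g y"
    using assms(5) unfolding exc_dist_def z(2) by linarith
  moreover have "z \<in> {x..y}" using z(1) assms(3) by simp
  ultimately show ?thesis using assms(3) by (meson atLeastAtMost_iff order_refl)
qed

text \<open>Pairing the points of \<open>P\<close> in increasing order, first with second, third with fourth, leaves a gap
  of at least \<open>\<rho>\<close> between consecutive intervals, as \<open>covering_number_graph_ge\<close> requires. There are
  \<open>card P div 2\<close> pairs, at least a third of \<open>card P\<close>. Here \<open>h\<close> sends old parameters to new ones.\<close>

lemma covering_number_reparametrized_graph_ge:
  fixes g h \<phi> :: "real \<Rightarrow> real"
  assumes \<phi>: "continuous_on {0..1} \<phi>" "\<And>x. x \<in> {0..1} \<Longrightarrow> \<phi> (h x) = g x + c"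
    and h: "mono_on {0..1} h" "h 0 = 0" "h 1 = 1"
    and P: "finite P" "P \<subseteq> {0..1}" "2 \<le> card P"
    and osc: "\<And>x y. x \<in> P \<Longrightarrow> y \<in> P \<Longrightarrow> x < y \<Longrightarrow> \<exists>a\<in>{x..y}. \<exists>b\<in>{x..y}. g a + L \<le> g b"
    and gap: "\<And>x y. x \<in> P \<Longrightarrow> y \<in> P \<Longrightarrow> x < y \<Longrightarrow> \<rho> \<le> h y - h x"
    and \<rho>: "0 < \<rho>" and L: "0 \<le> L"
  shows "card P / 3 * (L / \<rho>)
    \<le> covering_number (submetric euclidean_metric ((\<lambda>t. (t, \<phi> t)) ` {0..1})) (\<rho> / 2)"
proof -
  define e where "e = (\<lambda>i. sorted_list_of_set P ! i)"
  define m where "m = card P div 2"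
  have e_mem: "e i \<in> P" if "i < card P" for i
    using that P(1) nth_mem[of i "sorted_list_of_set P"] by (simp add: e_def)
  have e_less: "e i < e j" if "i < j" "j < card P" for i j
    unfolding e_def using that P(1)
    by (intro sorted_wrt_nth_less[of "(<)"]) auto
  have bd: "2 * i < card P" "2 * i + 1 < card P" if "i < m" for i
    using that by (auto simp: m_def)
  have h_le: "h x \<le> h y" if "x \<in> {0..1}" "y \<in> {0..1}" "x \<le> y" for x y
    using h(1) that by (auto simp: monotone_on_def)
  have "m * (L / \<rho>) \<le> covering_number (submetric euclidean_metric ((\<lambda>t. (t, \<phi> t)) ` {0..1})) (\<rho> / 2)"
  proof (rule covering_number_graph_ge[OF \<phi>(1), where u = "\<lambda>i. h (e (2 * i))" and v = "\<lambda>i. h (e (2 * i + 1))"])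
    show "0 \<le> h (e (2 * i)) \<and> h (e (2 * i + 1)) \<le> 1" if "i < m" for i
    proof -
      have "e (2 * i) \<in> {0..1}" "e (2 * i + 1) \<in> {0..1}" using e_mem bd[OF that] P(2) by blast+
      then show ?thesis using h_le[of 0 "e (2 * i)"] h_le[of "e (2 * i + 1)" 1] h by auto
    qed
    show "h (e (2 * i + 1)) + \<rho> \<le> h (e (2 * j))" if "i < j" "j < m" for i j
      using gap[OF e_mem e_mem e_less, of "2 * i + 1" "2 * j"] that bd[of i] bd[of j] by simp
    show "\<exists>a\<in>{h (e (2 * i))..h (e (2 * i + 1))}. \<exists>b\<in>{h (e (2 * i))..h (e (2 * i + 1))}. \<phi> a + L \<le> \<phi> b"
      if "i < m" for i
    proof -
      have mem: "e (2 * i) \<in> P" "e (2 * i + 1) \<in> P" using e_mem bd[OF that] by auto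
      then have *: "e (2 * i) \<in> {0..1}" "e (2 * i + 1) \<in> {0..1}" using P(2) by blast+
      obtain a b where ab: "a \<in> {e (2 * i)..e (2 * i + 1)}" "b \<in> {e (2 * i)..e (2 * i + 1)}"
        "g a + L \<le> g b"
        using osc[OF mem] e_less[of "2 * i" "2 * i + 1"] bd(2)[OF \<open>i < m\<close>] by auto
      then have "a \<in> {0..1}" "b \<in> {0..1}" using * by auto
      with ab * show ?thesis
        by (intro bexI[of _ "h a"] bexI[of _ "h b"]) (auto simp: \<phi>(2) intro!: h_le)
    qed
  qed (use \<rho> L in auto)
  moreover have "card P / 3 * (L / \<rho>) \<le> m * (L / \<rho>)"
  proof (intro mult_right_mono)
    have "card P \<le> 3 * m" using P(3) unfolding m_def by presburger
    then have "real (card P) \<le> real (3 * m)" by (rule of_nat_mono)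
    then show "card P / 3 \<le> m" by simp
  qed (use \<rho> L in auto)
  ultimately show ?thesis by linarith
qed

section \<open>The exponent\<close>

text \<open>With \<open>X = - ln (\<rho> / 2)\<close>, the covering number \<open>N\<close> of the graph satisfies
  \<open>ln N \<ge> 2 X - (- ln s) - Z\<close>, where \<open>Z = k ln 2 + ln 144\<close> collects the factor \<open>2 ^ k\<close> and the
  constants. The lower bound on \<open>M\<close> gives \<open>- ln s \<le> q X\<close>, and the smallness of \<open>s\<close> gives
  \<open>Z \<le> \<epsilon> X\<close>. The theorem below uses it with \<open>q\<close> slightly above \<open>1 / D\<close>.\<close>

lemma exponent_bound:
  fixes M s q \<epsilon> N \<rho> :: real and k :: nat
  assumes s: "0 < s" "s < 1" and q: "0 < q" and \<epsilon>: "0 < \<epsilon>" and M: "1 < M" "- ln s / q \<le> ln M"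
    and small: "(k * ln 2 + ln 144) * q \<le> \<epsilon> * - ln s"
    and \<rho>: "\<rho> = 1 / (3 * 2 ^ k * M)" and N: "M / 3 * (s / 4 / \<rho>) \<le> N"
  shows "2 - q - \<epsilon> \<le> ln N / - ln (\<rho> / 2)"
proof -
  define X where "X = - ln (\<rho> / 2)"
  define Y where "Y = - ln s"
  define Z where "Z = k * ln 2 + ln (144::real)"
  have "0 < \<rho>" using M by (simp add: \<rho>)
  have "0 < Y" using s by (simp add: Y_def)
  have "X = ln (6 * 2 ^ k * M)"
    unfolding X_def \<rho> using M by (simp add: ln_div)
  also have "\<dots> = ln 6 + k * ln 2 + ln M" using M by (simp add: ln_mult ln_realpow)
  finally have "ln M \<le> X" by simp
  then have "Y / q \<le> X" using M(2) by (simp add: Y_def)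
  then have YX: "Y \<le> q * X" using q by (simp add: pos_divide_le_eq mult.commute)
  then have "0 < X" using \<open>0 < Y\<close> q by (smt (verit) zero_less_mult_pos)
  have "Z * q \<le> \<epsilon> * Y" using small by (simp add: Z_def Y_def)
  also have "\<dots> \<le> \<epsilon> * (q * X)" using YX \<epsilon> by simp
  finally have ZX: "Z \<le> \<epsilon> * X" using q by (simp add: mult.assoc mult.left_commute mult.commute)
  \<comment> \<open>Replacing \<open>M\<close> by \<open>1 / (3 2 ^ k \<rho>)\<close> makes the second factor \<open>1 / \<rho>\<close> that the leading
    \<open>2 X\<close> needs; the numerical factors multiply to \<open>144\<close>.\<close>
  have "M / 3 * (s / 4 / \<rho>) = s / (144 * 2 ^ k * (\<rho> / 2)\<^sup>2)"
    unfolding \<rho> using M by (simp add: field_simps power2_eq_square)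
  then have "ln (s / (144 * 2 ^ k * (\<rho> / 2)\<^sup>2)) \<le> ln N"
    using N s \<open>0 < \<rho>\<close> by (simp add: ln_mono)
  moreover have "ln (s / (144 * 2 ^ k * (\<rho> / 2)\<^sup>2)) = 2 * X - Y - Z"
    using s \<open>0 < \<rho>\<close> by (simp add: X_def Y_def Z_def ln_mult ln_div ln_realpow)
  ultimately have "(2 - q - \<epsilon>) * X \<le> ln N" using YX ZX by (simp add: left_diff_distrib)
  then show ?thesis using \<open>0 < X\<close> by (simp add: pos_le_divide_eq flip: X_def)
qed

lemma less_of_one_div_less:
  fixes D :: ereal
  assumes "0 < D" "1 / D = ereal q" "q < q'"
  shows "ereal (1 / q') < D"
proof (cases D)
  case (real d)
  then have "q = 1 / d" "0 < d" using assms by (auto simp: one_ereal_def)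
  moreover from this have "0 < q'" using assms(3) by (smt (verit) divide_pos_pos)
  moreover have "d * q < d * q'" using calculation(2) assms(3) by simp
  ultimately show ?thesis using real by (simp add: field_simps)
qed (use assms in auto)

section \<open>The homeomorphism\<close>

theorem exists_reparametrization_upper_box_dim_graph_ge:
  fixes f :: "complex \<Rightarrow> real"
  assumes f: "continuous_on circle f" and D: "D = upper_box_dim (circle_tree f)" "0 < D"
  shows "\<exists>\<tau> \<sigma>. homeomorphism circle circle \<tau> \<sigma> \<and>
           upper_box_dim (submetric euclidean_metric (circle_graph (f \<circ> \<tau>))) \<ge> 2 - 1 / D"
proof -
  define g where "g = rebase f"
  have g: "excursion g" unfolding g_def by (rule excursion_rebase[OF f])
  obtain q where q: "1 / D = ereal q" "0 \<le> q"
  proof (cases D)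
    case (real d)
    then show ?thesis using D(2) by (intro that[of "1 / d"]) (auto simp: one_ereal_def)
  qed (use D(2) that[of 0] in \<open>auto simp: zero_ereal_def\<close>)
  define \<epsilon> where "\<epsilon> = (\<lambda>k. 1 / real (Suc k))"
  \<comment> \<open>Exponents \<open>1 / Q k\<close> strictly below \<open>D\<close> that tend to it; working with the reciprocals covers
    infinite \<open>D\<close> as well.\<close>
  define Q where "Q = (\<lambda>k. q + \<epsilon> k)"
  have \<epsilon>: "0 < \<epsilon> k" for k by (simp add: \<epsilon>_def)
  have Q: "0 < Q k" "ereal (1 / Q k) < upper_box_dim (exc_tree g)" for k
    using less_of_one_div_less[OF D(2) q(1), of "Q k"] \<epsilon>[of k] q(2) D(1)
    by (auto simp: Q_def g_def circle_tree_def)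
  \<comment> \<open>A scale below \<open>exp (- Z k)\<close> meets the smallness condition of \<open>exponent_bound\<close>.\<close>
  define Z where "Z = (\<lambda>k. (real k * ln 2 + ln 144) * Q k / \<epsilon> k)"
  have "\<exists>s>0. s < min 1 (exp (- Z k)) \<and> 1 / Q k < ln (real (covering_number (exc_tree g) s)) / - ln s" for k
    by (rule exists_scale_above_exponent[OF Q(2)]) simp
  then obtain s where s: "\<And>k. 0 < s k" "\<And>k. s k < 1" "\<And>k. s k < exp (- Z k)"
    "\<And>k. 1 / Q k < ln (real (covering_number (exc_tree g) (s k))) / - ln (s k)"
    by (metis min_less_iff_conj)
  have "\<exists>P. finite P \<and> P \<subseteq> {0..1} \<and> card P = covering_number (exc_tree g) (s k) \<and>
      (\<forall>x\<in>P. \<forall>y\<in>P. x \<noteq> y \<longrightarrow> s k / 2 < exc_dist g x y)" for k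
    by (rule exc_tree_separated_points[OF g less_imp_le[OF s(1)], of k]) blast
  then obtain P where P: "\<And>k. finite (P k)" "\<And>k. P k \<subseteq> {0..1}"
    "\<And>k. card (P k) = covering_number (exc_tree g) (s k)"
    "\<And>k x y. x \<in> P k \<Longrightarrow> y \<in> P k \<Longrightarrow> x \<noteq> y \<Longrightarrow> s k / 2 < exc_dist g x y"
    by metis
  have lnM: "- ln (s k) / Q k \<le> ln (card (P k))" for k
    using s(1,2,4)[of k] Q(1)[of k] P(3)[of k]
    by (simp add: field_simps)
  have lnM_pos: "0 < ln (card (P k))" for k
    using lnM[of k] s(1,2)[of k] Q(1)[of k] by (smt (verit) divide_pos_pos ln_less_zero)
  have card2: "2 \<le> card (P k)" for k
  proof -
    have "card (P k) \<noteq> 0" "card (P k) \<noteq> 1" using lnM_pos[of k] by (auto intro: ccontr)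
    then show ?thesis by simp
  qed
  obtain h :: "real \<Rightarrow> real" where h: "continuous_on {0..1} h" "strict_mono_on {0..1} h" "h 0 = 0" "h 1 = 1"
    "\<And>k x y. x \<in> P k \<Longrightarrow> y \<in> P k \<Longrightarrow> 0 \<le> x \<Longrightarrow> x < y \<Longrightarrow> y \<le> 1 \<Longrightarrow>
       1 / (3 * 2 ^ k * real (card (P k))) \<le> h y - h x"
    using exists_spreading_function[of P] P(1) by metis
  have h_mono: "mono_on {0..1} h" using h(2) by (rule strict_mono_on_imp_mono_on)
  have h_inj: "inj_on h {0..1}" using h(2) by (rule strict_mono_on_imp_inj_on)
  have h_img: "h ` {0..1} = {0..1}"
  proof
    show "h ` {0..1} \<subseteq> {0..1}"
    proof
      fix y assume "y \<in> h ` {0..1}"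
      then obtain x where "x \<in> {0..1}" "y = h x" by blast
      then show "y \<in> {0..1}" using mono_onD[OF h_mono, of 0 x] mono_onD[OF h_mono, of x 1] h(3,4) by auto
    qed
    show "{0..1} \<subseteq> h ` {0..1}"
    proof
      fix y :: real assume "y \<in> {0..1}"
      then show "y \<in> h ` {0..1}" using IVT'[of h 0 y 1] h by force
    qed
  qed
  define \<kappa> where "\<kappa> = the_inv_into {0..1} h"
  have \<kappa>h: "\<kappa> (h x) = x" if "x \<in> {0..1}" for x
    unfolding \<kappa>_def by (rule the_inv_into_f_f[OF h_inj that])
  have \<kappa>_bij: "bij_betw \<kappa> {0..1} {0..1}"
    unfolding \<kappa>_def by (rule bij_betw_the_inv_into) (simp add: bij_betw_def h_inj h_img)
  have \<kappa>_cont: "continuous_on {0..1} \<kappa>"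
    using continuous_on_inv[OF h(1), of \<kappa>] \<kappa>h h_img by simp
  have \<kappa>_ends: "\<kappa> 0 = 0" "\<kappa> 1 = 1" using \<kappa>h[of 0] \<kappa>h[of 1] h(3,4) by auto
  obtain \<tau> \<sigma> where \<tau>: "homeomorphism circle circle \<tau> \<sigma>"
    "\<And>t. t \<in> {0..1} \<Longrightarrow> \<tau> (circle_point t) = circle_point (\<kappa> t + min_point f)"
    using circle_reparametrization[OF \<kappa>_cont \<kappa>_bij \<kappa>_ends, of "min_point f"] by blast
  define c where "c = f (circle_point (min_point f))"
  define \<phi> where "\<phi> = (\<lambda>t. g (\<kappa> t) + c)"
  have graph: "circle_graph (f \<circ> \<tau>) = (\<lambda>t. (t, \<phi> t)) ` {0..1}"
    unfolding circle_graph_def by (intro image_cong refl) (simp add: \<tau>(2) \<phi>_def g_def rebase_def c_def)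
  have "continuous_on {0..1} g" using g by (simp add: excursion_def)
  then have "continuous_on {0..1} (\<lambda>t. g (\<kappa> t))"
    by (rule continuous_on_compose2[OF _ \<kappa>_cont]) (use \<kappa>_bij in \<open>simp add: bij_betw_def\<close>)
  then have \<phi>_cont: "continuous_on {0..1} \<phi>" unfolding \<phi>_def by (intro continuous_intros)
  define \<rho> where "\<rho> = (\<lambda>k. 1 / (3 * 2 ^ k * real (card (P k))))"
  have \<rho>_pos: "0 < \<rho> k" for k using card2[of k] by (simp add: \<rho>_def)
  let ?N = "covering_number (submetric euclidean_metric (circle_graph (f \<circ> \<tau>)))"
  have N: "card (P k) / 3 * (s k / 4 / \<rho> k) \<le> ?N (\<rho> k / 2)" for k
    unfolding graph
  proof (rule covering_number_reparametrized_graph_ge[OF \<phi>_cont _ h_mono h(3,4) P(1,2) card2])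
    show "\<phi> (h x) = g x + c" if "x \<in> {0..1}" for x using \<kappa>h[OF that] by (simp add: \<phi>_def)
    show "\<exists>a\<in>{x..y}. \<exists>b\<in>{x..y}. g a + s k / 4 \<le> g b" if "x \<in> P k" "y \<in> P k" "x < y" for x y
      using P(4)[OF that(1,2)] that P(2)[of k] by (intro exc_dist_imp_oscillation[OF g]) auto
    show "\<rho> k \<le> h y - h x" if "x \<in> P k" "y \<in> P k" "x < y" for x y
    proof -
      have "0 \<le> x" "y \<le> 1" using P(2)[of k] that by auto
      then show ?thesis using h(5)[OF that(1,2)] that(3) by (simp add: \<rho>_def)
    qed
  qed (use \<rho>_pos[of k] s(1)[of k] in simp_all)
  have bound: "2 - Q k - \<epsilon> k \<le> ln (real (?N (\<rho> k / 2))) / - ln (\<rho> k / 2)" for k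
  proof (rule exponent_bound[OF s(1,2) Q(1) \<epsilon> _ lnM _ _ N])
    have "ln (s k) < - Z k" using s(1,3)[of k] by (metis ln_exp ln_less_cancel_iff exp_gt_zero)
    then have "Z k * \<epsilon> k \<le> - ln (s k) * \<epsilon> k" using \<epsilon>[of k] by (intro mult_right_mono) auto
    then show "(k * ln 2 + ln 144) * Q k \<le> \<epsilon> k * - ln (s k)"
      using \<epsilon>[of k] by (simp add: Z_def mult.commute)
    show "1 < real (card (P k))" using card2[of k] by simp
  qed (simp add: \<rho>_def)
  have \<epsilon>_lim: "\<epsilon> \<longlonglongrightarrow> 0"
    unfolding \<epsilon>_def using LIMSEQ_inverse_real_of_nat by (simp add: inverse_eq_divide)
  have "(\<lambda>k. \<rho> k / 2) \<longlonglongrightarrow> 0"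
  proof (rule tendsto_sandwich[of "\<lambda>_. 0"])
    show "(\<lambda>k. (1/2::real) ^ k) \<longlonglongrightarrow> 0" by (rule LIMSEQ_power_zero) simp
    have "\<rho> k / 2 \<le> (1/2)^k" for k
      using card2[of k] by (simp add: \<rho>_def field_simps)
    then show "eventually (\<lambda>k. \<rho> k / 2 \<le> (1/2)^k) sequentially" by simp
  qed (use \<rho>_pos in \<open>simp_all add: less_imp_le\<close>)
  moreover have "\<rho> k \<noteq> 0" for k using \<rho>_pos[of k] by simp
  ultimately have "filterlim (\<lambda>k. \<rho> k / 2) (at_right 0) sequentially"
    using \<rho>_pos by (simp add: filterlim_at)
  moreover have "(\<lambda>k. ereal (2 - Q k - \<epsilon> k)) \<longlonglongrightarrow> ereal (2 - (q + 0) - 0)"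
    unfolding Q_def by (intro tendsto_ereal tendsto_diff tendsto_add tendsto_const \<epsilon>_lim)
  ultimately have "ereal (2 - (q + 0) - 0) \<le> upper_box_dim (submetric euclidean_metric (circle_graph (f \<circ> \<tau>)))"
    unfolding upper_box_dim_def by (rule le_Limsup_along) (use bound in simp)
  moreover have "2 - 1 / D = ereal (2 - q)" unfolding q(1) by (metis ereal_minus(1) numeral_eq_ereal)
  ultimately show ?thesis using \<tau>(1) by auto
qed

theorem corollary5p4:
  fixes f :: "complex \<Rightarrow> real"
  assumes "continuous_on circle f" and "\<not> f constant_on circle"
  shows "\<exists>\<tau> \<sigma>. homeomorphism circle circle \<tau> \<sigma> \<and>
           upper_box_dim (submetric euclidean_metric (circle_graph (f \<circ> \<tau>)))
             \<ge> 2 - 1 / modified_upper_box_dim (circle_tree f)"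
proof (cases "modified_upper_box_dim (circle_tree f) = 0")
  case True
  \<comment> \<open>Here \<open>1 / 0 = \<infinity>\<close>, so the bound is \<open>- \<infinity>\<close>.\<close>
  have "homeomorphism circle circle id id" by (simp add: homeomorphism_def)
  moreover have "2 - 1 / modified_upper_box_dim (circle_tree f) = - \<infinity>" by (simp add: True divide_ereal_def)
  ultimately show ?thesis by (metis ereal_less_eq(2))
next
  case False
  then have pos: "0 < modified_upper_box_dim (circle_tree f)"
    using modified_upper_box_dim_nonneg[of "circle_tree f"] by simp
  have le: "modified_upper_box_dim (circle_tree f) \<le> upper_box_dim (circle_tree f)"
    by (rule modified_upper_box_dim_le)
  obtain \<tau> \<sigma> where \<tau>: "homeomorphism circle circle \<tau> \<sigma>"
    "2 - 1 / upper_box_dim (circle_tree f)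
      \<le> upper_box_dim (submetric euclidean_metric (circle_graph (f \<circ> \<tau>)))"
    using exists_reparametrization_upper_box_dim_graph_ge[OF assms(1) refl less_le_trans[OF pos le]]
    by blast
  have "1 / upper_box_dim (circle_tree f) \<le> 1 / modified_upper_box_dim (circle_tree f)"
    using pos le by (simp add: divide_ereal_def ereal_inverse_antimono)
  then have "2 - 1 / modified_upper_box_dim (circle_tree f) \<le> 2 - 1 / upper_box_dim (circle_tree f)"
    by (intro ereal_minus_mono) auto
  with \<tau> show ?thesis by (meson order_trans)
qed

end
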